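(* Let $n\ge 3$ and let $C_n$ be the circuit (cycle graph) with $n$ edges. The smallest positive integer $k$ for which the cut ideal $IC_n$ is $\mathrm{TH}_k$-exact is $k=\lceil n/4\rceil$.
   Context: For a finite simple graph $G=(V,E)$ and $S\subseteq V$, the cut corresponding to $S$ is the set $D$ of edges with exactly one endpoint in $S$; its cut vector $\chi^D\in\{\pm1\}^E$ has $\chi^D_e=-1$ if $e\in D$ and $1$ otherwise. The cut ideal $IG\subseteq\mathbb{R}[x_e:e\in E]$ is the ideal of all polynomials vanishing at all cut vectors of $G$. For an ideal $I$ of a real polynomial ring in finitely many variables, with real variety $V_{\mathbb{R}}(I)$, a polynomial $f$ is $k$-sos modulo $I$ if $f=\sum_{i=1}^t g_i^2+h$ with $h\in I$ and polynomials $g_i$ of degree at most $k$. The $k$-th theta body $\mathrm{TH}_k(I)$ is the set of real points $\mathbf{x}$ with $f(\mathbf{x})\ge0$ for every polynomial $f$ of degree at most $1$ that is $k$-sos modulo $I$. The ideal $I$ is $\mathrm{TH}_k$-exact if $\overline{\mathrm{conv}(V_{\mathbb{R}}(I))}=\mathrm{TH}_k(I)$. *)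

theory Defs
  imports "HOL-Analysis.Analysis" "HOL-Library.Poly_Mapping"
begin

section \<open>Real polynomials in finitely many variables\<close>

text \<open>
  The ring \<open>\<real>[x\<^sub>e : e \<in> E]\<close> is the ring of finitely supported functions from
  monomials (exponent vectors) to coefficients; the finite type \<open>'e\<close> is the index
  set \<open>E\<close>. The corresponding real affine space \<open>\<real>\<^sup>E\<close> is \<^typ>\<open>real ^ 'e\<close>.
\<close>

type_synonym 'e mpoly = "('e \<Rightarrow>\<^sub>0 nat) \<Rightarrow>\<^sub>0 real"

definition poly_eval :: "real ^ 'e::finite \<Rightarrow> 'e mpoly \<Rightarrow> real" where
  "poly_eval x p =
     (\<Sum>m\<in>Poly_Mapping.keys p. Poly_Mapping.lookup p m * (\<Prod>e\<in>UNIV. (x $ e) ^ Poly_Mapping.lookup m e))"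

lemma mpoly_induct [case_names single sum]:
  fixes p :: "'e mpoly"
  assumes single: "\<And>m c. P (Poly_Mapping.single m c)"
    and sum: "\<And>p q. P p \<Longrightarrow> P q \<Longrightarrow> P (p + q)"
  shows "P p"
proof (induction p rule: update_induct)
  case const
  show ?case using single[of 0 0] by simp
next
  case (update f a b)
  have "Poly_Mapping.update a b f = f + Poly_Mapping.single a b"
    using update by (intro poly_mapping_eqI)
      (auto simp: lookup_update lookup_add lookup_single in_keys_iff when_def)
  then show ?case using sum[OF update(3) single] by simp
qed

lemma poly_eval_superset:
  assumes "finite A" "Poly_Mapping.keys p \<subseteq> A"
  shows "poly_eval x p = (\<Sum>m\<in>A. Poly_Mapping.lookup p m * (\<Prod>e\<in>UNIV. (x $ e) ^ Poly_Mapping.lookup m e))"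
  unfolding poly_eval_def
  using assms by (intro sum.mono_neutral_left) (auto simp: in_keys_iff)

lemma poly_eval_add: "poly_eval x (p + q) = poly_eval x p + poly_eval x q"
proof -
  let ?A = "Poly_Mapping.keys p \<union> Poly_Mapping.keys q"
  have "Poly_Mapping.keys (p + q) \<subseteq> ?A" by (rule Poly_Mapping.keys_add)
  then show ?thesis
    by (simp add: poly_eval_superset[of ?A] lookup_add distrib_right sum.distrib)
qed

lemma poly_eval_single:
  "poly_eval x (Poly_Mapping.single m c) = c * (\<Prod>e\<in>UNIV. (x $ e) ^ Poly_Mapping.lookup m e)"
  by (simp add: poly_eval_def)

lemma poly_eval_mult: "poly_eval x (p * q) = poly_eval x p * poly_eval x q"
proof (induction p rule: mpoly_induct)
  case (single m c)
  show ?case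
  proof (induction q rule: mpoly_induct)
    case (single m' c')
    show ?case by (simp add: mult_single poly_eval_single lookup_add power_add prod.distrib)
  next
    case (sum q r)
    then show ?case by (simp add: distrib_left poly_eval_add)
  qed
next
  case (sum p r)
  then show ?case by (simp add: distrib_right poly_eval_add)
qed

text \<open>The total degree; the zero polynomial gets degree 0.\<close>

definition total_degree :: "'e::finite mpoly \<Rightarrow> nat" where
  "total_degree p = Max (insert 0 ((\<lambda>m. \<Sum>e\<in>UNIV. Poly_Mapping.lookup m e) ` Poly_Mapping.keys p))"

definition real_variety :: "'e::finite mpoly set \<Rightarrow> (real ^ 'e) set" where
  "real_variety I = {x. \<forall>p\<in>I. poly_eval x p = 0}"


section \<open>Theta bodies\<close>

definition sos_mod :: "nat \<Rightarrow> 'e::finite mpoly set \<Rightarrow> 'e mpoly \<Rightarrow> bool" where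
  "sos_mod k I f \<longleftrightarrow>
     (\<exists>(t::nat) g. \<exists>h\<in>I. (\<forall>i<t. total_degree (g i) \<le> k) \<and> f = (\<Sum>i<t. (g i)\<^sup>2) + h)"

definition theta_body :: "nat \<Rightarrow> 'e::finite mpoly set \<Rightarrow> (real ^ 'e) set" where
  "theta_body k I = {x. \<forall>f. total_degree f \<le> 1 \<and> sos_mod k I f \<longrightarrow> poly_eval x f \<ge> 0}"

definition theta_exact :: "nat \<Rightarrow> 'e::finite mpoly set \<Rightarrow> bool" where
  "theta_exact k I \<longleftrightarrow> closure (convex hull (real_variety I)) = theta_body k I"


section \<open>Cut ideals of finite simple graphs\<close>

text \<open>
  A graph is given by its vertex set \<open>V\<close> and the map \<open>inc\<close> that sends an edge to the
  set of its two endpoints, so that all of the finite type \<open>'e\<close> is the edge set.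
  Injectivity of \<open>inc\<close> excludes parallel edges.
\<close>

definition simple_graph :: "'a set \<Rightarrow> ('e::finite \<Rightarrow> 'a set) \<Rightarrow> bool" where
  "simple_graph V inc \<longleftrightarrow> finite V \<and> inj inc \<and> (\<forall>e. inc e \<subseteq> V \<and> card (inc e) = 2)"

definition cut :: "('e::finite \<Rightarrow> 'a set) \<Rightarrow> 'a set \<Rightarrow> 'e set" where
  "cut inc S = {e. card (inc e \<inter> S) = 1}"

definition cut_vector :: "'e::finite set \<Rightarrow> real ^ 'e" where
  "cut_vector D = (\<chi> e. if e \<in> D then -1 else 1)"

definition cut_ideal :: "'a set \<Rightarrow> ('e::finite \<Rightarrow> 'a set) \<Rightarrow> 'e mpoly set" where
  "cut_ideal V inc = {p. \<forall>S\<subseteq>V. poly_eval (cut_vector (cut inc S)) p = 0}"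


lemma cut_ideal_ideal:
  shows "0 \<in> cut_ideal V inc"
    and "p \<in> cut_ideal V inc \<Longrightarrow> q \<in> cut_ideal V inc \<Longrightarrow> p + q \<in> cut_ideal V inc"
    and "p \<in> cut_ideal V inc \<Longrightarrow> r * p \<in> cut_ideal V inc"
  by (auto simp: cut_ideal_def poly_eval_add poly_eval_mult) (simp add: poly_eval_def)


section \<open>Cycle graphs\<close>

text \<open>
  \<open>C\<^sub>n\<close> up to isomorphism: vertices \<open>v 0, \<dots>, v (n - 1)\<close> and edges \<open>d 0, \<dots>, d (n - 1)\<close>,
  where \<open>d i\<close> joins \<open>v i\<close> to its cyclic successor.
\<close>

definition cycle_graph :: "nat \<Rightarrow> 'a set \<Rightarrow> ('e::finite \<Rightarrow> 'a set) \<Rightarrow> bool" where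
  "cycle_graph n V inc \<longleftrightarrow>
     (\<exists>v d. bij_betw v {..<n} V \<and> bij_betw d {..<n} (UNIV :: 'e set) \<and>
            (\<forall>i<n. inc (d i) = {v i, v (Suc i mod n)}))"

lemma cycle_graph_card:
  fixes inc :: "'e::finite \<Rightarrow> 'a set"
  assumes "cycle_graph n V inc"
  shows "card V = n" and "CARD('e) = n"
  using assms unfolding cycle_graph_def by (metis bij_betw_same_card card_lessThan)+

lemma cycle_graph_simple_graph:
  fixes inc :: "'e::finite \<Rightarrow> 'a set"
  assumes "n \<ge> 3" "cycle_graph n V inc"
  shows "simple_graph V inc"
proof -
  obtain v d where v: "bij_betw v {..<n} V" and d: "bij_betw d {..<n} (UNIV :: 'e set)"
    and inc: "\<And>i. i < n \<Longrightarrow> inc (d i) = {v i, v (Suc i mod n)}"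
    using assms(2) unfolding cycle_graph_def by blast
  have v_eq: "v i = v j \<longleftrightarrow> i = j" if "i < n" "j < n" for i j
    using v that by (auto simp: bij_betw_def inj_on_def)
  have suc: "Suc i mod n < n" "Suc i mod n \<noteq> i" if "i < n" for i
    using that assms(1) by (auto simp: mod_Suc)
  have edge: "\<exists>i<n. e = d i" for e
    using d unfolding bij_betw_def by auto
  have "inc e \<subseteq> V \<and> card (inc e) = 2" for e
  proof -
    obtain i where i: "i < n" "e = d i" using edge by blast
    have "v i \<noteq> v (Suc i mod n)" using v_eq suc i by metis
    moreover have "v i \<in> V" "v (Suc i mod n) \<in> V"
      using v i suc by (auto simp: bij_betw_def)
    ultimately show ?thesis using inc i by auto
  qed
  moreover have "inj inc"
  proof (rule injI)
    fix e e' assume eq: "inc e = inc e'"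
    obtain i j where ij: "i < n" "e = d i" "j < n" "e' = d j" using edge by metis
    have "{v i, v (Suc i mod n)} = {v j, v (Suc j mod n)}"
      using eq inc ij by simp
    then have "i = j \<or> (i = Suc j mod n \<and> Suc i mod n = j)"
      using v_eq suc ij by (metis doubleton_eq_iff)
    then have "i = j"
      using ij assms(1) by (auto simp: mod_Suc split: if_splits)
    then show "e = e'" using ij by simp
  qed
  moreover have "finite V"
    using v bij_betw_finite by blast
  ultimately show ?thesis unfolding simple_graph_def by blast
qed

end

theory Submission
  imports Defs "HOL-Computational_Algebra.Fundamental_Theorem_Algebra"
begin

text \<open>
  The cut vectors of the cycle are the sign vectors whose coordinates have product \<open>1\<close>. Their
  convex hull is cut out by the box inequalities and by \<open>y \<bullet> x \<le> n - 2\<close> for the sign vectors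
  \<open>y\<close> with product \<open>-1\<close>. After scaling, each of these inequalities reads \<open>f \<ge> 0\<close> with \<open>f\<close> linear and
  with values in \<open>{0, 1, \<dots>, 2k - 1}\<close> on the cut vectors as soon as \<open>n \<le> 4k\<close>. A univariate
  polynomial of degree \<open>2k\<close> that is nonnegative on the real line and agrees with the identity at these
  values is a sum of two squares, and composing it with \<open>f\<close> shows that \<open>f\<close> is \<open>k\<close>-sos.

  If \<open>4k < n\<close>, polynomials of degree at most \<open>2k\<close> that vanish on all cut vectors vanish on all sign
  vectors, so the \<open>k\<close>-th theta body contains every sign vector.
\<close>

section \<open>Nonnegative univariate polynomials\<close>

text \<open>Cancelling a factor that vanishes only at \<open>u\<close> leaves the sign of the
  quotient unknown there; continuity recovers it.\<close>

lemma poly_nonneg_at_puncture: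
  fixes q :: "real poly"
  assumes "\<And>x. x \<noteq> u \<Longrightarrow> poly q x \<ge> 0"
  shows "poly q u \<ge> 0"
proof (rule tendsto_lowerbound)
  show "(poly q \<longlongrightarrow> poly q u) (at u)"
    using isCont_def poly_isCont by blast
  show "\<forall>\<^sub>F x in at u. 0 \<le> poly q x"
    by (auto simp: eventually_at_filter assms)
qed simp

text \<open>A zero of a nonnegative polynomial is a minimum, so the derivative vanishes as well and
  the root is at least double.\<close>

lemma nonneg_poly_root_square_dvd:
  fixes p :: "real poly"
  assumes nn: "\<And>x. poly p x \<ge> 0" and root: "poly p u = 0"
  shows "[:u\<^sup>2, - 2 * u, 1:] dvd p"
proof -
  have der: "poly (pderiv p) u = 0"
    by (rule DERIV_local_min[of "poly p" _ u 1]) (auto simp: poly_DERIV nn root)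
  obtain q where q: "p = [:-u, 1:] * q"
    using root by (metis poly_eq_0_iff_dvd dvdE)
  have "poly q u = 0"
    using der unfolding q pderiv_mult by (simp add: pderiv_pCons)
  then obtain r where "q = [:-u, 1:] * r"
    by (metis poly_eq_0_iff_dvd dvdE)
  then have "p = ([:-u, 1:] * [:-u, 1:]) * r"
    using q by (simp only: mult.assoc)
  moreover have "[:-u, 1:] * [:-u, 1:] = [:u\<^sup>2, - 2 * u, 1:]"
    by (simp add: power2_eq_square)
  ultimately show ?thesis by (metis dvd_triv_left)
qed

section \<open>Real polynomials and their complex roots\<close>

lemma map_poly_of_real_add:
  "map_poly (of_real :: real \<Rightarrow> complex) (p + q) = map_poly of_real p + map_poly of_real q"
  by (intro poly_eqI) (simp add: coeff_map_poly)

lemma map_poly_of_real_mult: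
  "map_poly (of_real :: real \<Rightarrow> complex) (p * q) = map_poly of_real p * map_poly of_real q"
  by (intro poly_eqI) (simp add: coeff_map_poly coeff_mult)

lemma poly_map_poly_of_real:
  "poly (map_poly (of_real :: real \<Rightarrow> complex) p) (of_real x) = of_real (poly p x)"
  by (induction p) (simp_all add: map_poly_pCons)

text \<open>The divisor has roots \<open>z\<close> and its conjugate. The remainder
  \<open>c + d x\<close> also vanishes at \<open>z\<close>: the imaginary part forces
  \<open>d = 0\<close>, then the real part forces \<open>c = 0\<close>.\<close>

lemma poly_complex_root_dvd:
  fixes p :: "real poly"
  assumes root: "poly (map_poly complex_of_real p) z = 0" and "Im z \<noteq> 0"
  shows "[:(Re z)\<^sup>2 + (Im z)\<^sup>2, - 2 * Re z, 1:] dvd p"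
proof -
  define D where "D = [:(Re z)\<^sup>2 + (Im z)\<^sup>2, - 2 * Re z, 1:]"
  have "D \<noteq> 0" "degree D = 2" by (simp_all add: D_def)
  define r where "r = p mod D"
  have "degree r < 2 \<or> r = 0"
    using degree_mod_less[of D p] \<open>D \<noteq> 0\<close> \<open>degree D = 2\<close> by (auto simp: r_def)
  then consider "degree r = 0" | "degree r = 1" by fastforce
  then obtain c d where cd: "r = [:c, d:]"
    by cases (auto elim: degree_eq_zeroE degree1_coeffs simp del: One_nat_def)
  have "map_poly complex_of_real p
      = map_poly of_real D * map_poly of_real (p div D) + map_poly of_real r"
    unfolding map_poly_of_real_add[symmetric] map_poly_of_real_mult[symmetric]
    by (simp add: r_def)
  moreover have "poly (map_poly complex_of_real D) z = 0"
    by (simp add: D_def complex_eq_iff map_poly_pCons power2_eq_square algebra_simps)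
  ultimately have "poly (map_poly complex_of_real r) z = 0"
    using root by simp
  then have "r = 0"
    using \<open>Im z \<noteq> 0\<close> by (auto simp: cd complex_eq_iff map_poly_pCons)
  then show ?thesis unfolding r_def D_def by (simp add: mod_eq_0_iff_dvd)
qed

text \<open>A complex root splits off a quadratic factor that is itself a sum of two squares; the
  quotient stays nonnegative, and sums of two squares are closed under products.\<close>

lemma nonneg_poly_sum_two_squares:
  fixes p :: "real poly"
  assumes "\<And>x. poly p x \<ge> 0"
  shows "\<exists>a b. p = a\<^sup>2 + b\<^sup>2 \<and> 2 * degree a \<le> degree p \<and> 2 * degree b \<le> degree p"
  using assms
proof (induction "degree p" arbitrary: p rule: less_induct)
  case less
  show ?case
  proof (cases "degree p = 0")
    case True
    then obtain c where c: "p = [:c:]" by (meson degree_eq_zeroE)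
    then have "c \<ge> 0" using less.prems[of 0] by simp
    then have "p = [:sqrt c:]\<^sup>2 + 0\<^sup>2" by (simp add: c power2_eq_square)
    then show ?thesis by (metis degree_0 degree_pCons_0 mult_0_right le0)
  next
    case False
    then have "degree (map_poly complex_of_real p) \<noteq> 0"
      by (simp add: degree_map_poly)
    then obtain z where z: "poly (map_poly complex_of_real p) z = 0"
      using fundamental_theorem_of_algebra[of "map_poly complex_of_real p"]
      by (auto simp: constant_degree)
    define D where "D = [:(Re z)\<^sup>2 + (Im z)\<^sup>2, - 2 * Re z, 1:]"
    have "D dvd p"
    proof (cases "Im z = 0")
      case True
      then have "z = of_real (Re z)" by (simp add: complex_eq_iff)
      with z have "complex_of_real (poly p (Re z)) = 0"
        by (metis poly_map_poly_of_real)
      then show ?thesis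
        using nonneg_poly_root_square_dvd[of p "Re z"] less.prems True by (simp add: D_def)
    next
      case False
      then show ?thesis using poly_complex_root_dvd[OF z] by (simp add: D_def)
    qed
    then obtain q where q: "p = D * q" by blast
    have D_eq: "poly D x = (x - Re z)\<^sup>2 + (Im z)\<^sup>2" for x
      by (simp add: D_def power2_eq_square algebra_simps)
    have "q \<noteq> 0" "D \<noteq> 0" using False q by auto
    then have deg: "degree p = 2 + degree q"
      by (simp add: q degree_mult_eq) (simp add: D_def)
    \<comment> \<open>\<open>D\<close> vanishes at \<open>Re z\<close> when \<open>z\<close> is
      real, so this point is left to continuity.\<close>
    have q_nn: "poly q x \<ge> 0" if "x \<noteq> Re z" for x
    proof -
      have "poly D x > 0" using that by (simp add: D_eq add_pos_nonneg)
      then show ?thesis using less.prems[of x] by (simp add: q zero_le_mult_iff)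
    qed
    then have "poly q x \<ge> 0" for x
      using poly_nonneg_at_puncture[of "Re z" q] by (cases "x = Re z") auto
    then obtain a b where ab: "q = a\<^sup>2 + b\<^sup>2" "2 * degree a \<le> degree q" "2 * degree b \<le> degree q"
      using less.hyps[of q] deg by auto
    define l where "l = [:- Re z, 1:]"
    have "D = l\<^sup>2 + [:Im z:]\<^sup>2"
      by (simp add: D_def l_def power2_eq_square)
    \<comment> \<open>Brahmagupta-Fibonacci identity for the product of \<open>D\<close> and
      \<open>q\<close>.\<close>
    then have "p = (l * a - [:Im z:] * b)\<^sup>2 + (l * b + [:Im z:] * a)\<^sup>2"
      by (simp only: q ab(1)) (simp only: power2_eq_square algebra_simps)
    moreover have le: "degree (l * c) \<le> Suc (degree c)" "degree ([:Im z:] * c) \<le> degree c" for c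
      using degree_mult_le[of l c] degree_mult_le[of "[:Im z:]" c] by (simp_all add: l_def)
    have "2 * degree (l * a - [:Im z:] * b) \<le> degree p"
      using degree_diff_le_max[of "l * a" "[:Im z:] * b"] le[of a] le[of b] ab deg by linarith
    moreover have "2 * degree (l * b + [:Im z:] * a) \<le> degree p"
      using degree_add_le_max[of "l * b" "[:Im z:] * a"] le[of a] le[of b] ab deg by linarith
    ultimately show ?thesis by blast
  qed
qed

text \<open>In the step to \<open>Suc N\<close>, the new factor is at most \<open>N + 1\<close> if
  \<open>t \<le> N + 1\<close>. Otherwise \<open>t\<close> lies in the last unit interval, and each
  factor \<open>t - j\<close> is at most \<open>N + 2 - j\<close>; these bounds multiply to
  \<open>fact (Suc N)\<close>.\<close>

lemma prod_abs_diff_le_fact: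
  fixes t :: real
  assumes "0 \<le> t" "t \<le> real N + 1"
  shows "(\<Prod>j=1..N. \<bar>real j - t\<bar>) \<le> fact N"
  using assms
proof (induction N)
  case (Suc N)
  show ?case
  proof (cases "t \<le> real N + 1")
    case True
    have "(\<Prod>j=1..N. \<bar>real j - t\<bar>) * \<bar>real (Suc N) - t\<bar> \<le> fact N * real (Suc N)"
      using True Suc by (intro mult_mono prod_nonneg) auto
    then show ?thesis by (simp add: mult.commute)
  next
    case False
    have "(\<Prod>j=1..Suc N. \<bar>real j - t\<bar>) \<le> (\<Prod>j=1..Suc N. real (Suc (Suc N) - j))"
      using False Suc.prems by (intro prod_mono) (auto simp: of_nat_diff)
    also have "\<dots> = (\<Prod>j=1..Suc N. real j)"
      by (rule prod.reindex_bij_witness[of _ "\<lambda>j. Suc (Suc N) - j" "\<lambda>j. Suc (Suc N) - j"]) auto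
    also have "\<dots> = fact (Suc N)" by (simp only: fact_prod of_nat_prod)
    finally show ?thesis .
  qed
qed simp

text \<open>The product is at least 1 for \<open>t < 0\<close>, at most 1 on
  \<open>[0, N + 1]\<close> and nonpositive beyond, where an odd number of factors is negative. So
  its difference from 1 never has the sign opposite to \<open>t\<close>.\<close>

lemma times_one_minus_prod_nonneg:
  fixes t :: real
  assumes "odd N"
  shows "t * (1 - (\<Prod>j=1..N. 1 - t / real j)) \<ge> 0"
proof -
  consider "t < 0" | "0 \<le> t" "t \<le> real N + 1" | "t > real N + 1" by linarith
  then show ?thesis
  proof cases
    case 1
    then have "(\<Prod>j=1..N. 1 - t / real j) \<ge> 1"
      by (intro prod_ge_1) (auto simp: divide_le_0_iff)
    then show ?thesis using 1 by (simp add: mult_nonpos_nonpos)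
  next
    case 2
    have "(\<Prod>j=1..N. 1 - t / real j) \<le> (\<Prod>j=1..N. \<bar>1 - t / real j\<bar>)"
      by (metis abs_ge_self abs_prod)
    also have "\<dots> = (\<Prod>j=1..N. \<bar>real j - t\<bar> / real j)"
      by (intro prod.cong) (auto simp: field_simps abs_divide[symmetric])
    also have "\<dots> = (\<Prod>j=1..N. \<bar>real j - t\<bar>) / fact N"
      by (simp only: prod_dividef fact_prod of_nat_prod)
    also have "\<dots> \<le> 1"
      using prod_abs_diff_le_fact[OF 2] by simp
    finally show ?thesis using 2 by simp
  next
    case 3
    have "(\<Prod>j=1..N. 1 - t / real j) = (\<Prod>j=1..N. - (t / real j - 1))" by simp
    also have "\<dots> = - (\<Prod>j=1..N. t / real j - 1)"
      using assms by (simp only: prod_uminus card_atLeastAtMost) simp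
    also have "\<dots> \<le> 0"
      using 3 by (auto intro!: prod_nonneg simp: field_simps)
    finally show ?thesis using 3 by simp
  qed
qed

text \<open>The witness \<open>t (1 - \<Prod>j=1..2k-1. (1 - t/j))\<close> is \<open>t\<close> plus a multiple of
  \<open>t (t - 1) \<dots> (t - (2k-1))\<close>, the multiple being chosen so that the zero at \<open>0\<close> is double.\<close>

lemma nonneg_poly_interpolating_identity:
  assumes "k > 0"
  obtains p :: "real poly" where "degree p \<le> 2 * k" "\<And>x. poly p x \<ge> 0"
    "\<And>i. i < 2 * k \<Longrightarrow> poly p (real i) = real i"
proof -
  \<comment> \<open>The nodes other than 0 are \<open>1, ..., N\<close>: an odd number, as the sign
    analysis requires, and \<open>N + 1 = 2 * k\<close> bounds the degree.\<close>
  define N where "N = 2 * k - 1"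
  define P where "P = (\<Prod>j=1..N. [:1, - 1 / real j:])"
  define p where "p = [:0, 1:] * (1 - P)"
  have P: "poly P t = (\<Prod>j=1..N. 1 - t / real j)" for t
    by (simp add: P_def poly_prod)
  have p: "poly p t = t * (1 - (\<Prod>j=1..N. 1 - t / real j))" for t
    by (simp add: p_def P)
  have "degree P \<le> (\<Sum>j=1..N. 1)"
    unfolding P_def by (rule order_trans[OF degree_prod_sum_le]) (auto intro!: sum_mono)
  then have "degree (1 - P) \<le> N" by (intro degree_diff_le) auto
  then have "degree p \<le> 2 * k"
    unfolding p_def using assms
    by (intro order_trans[OF degree_mult_le]) (simp add: N_def)
  moreover have "odd N" using assms by (simp add: N_def)
  then have "poly p x \<ge> 0" for x
    using times_one_minus_prod_nonneg[of N x] by (simp add: p)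
  moreover have "poly p (real i) = real i" if "i < 2 * k" for i
  proof (cases "i = 0")
    case False
    then have "(\<Prod>j=1..N. 1 - real i / real j) = 0"
      using that by (intro prod_zero) (auto simp: N_def intro!: bexI[of _ i])
    then show ?thesis by (simp add: p)
  qed (simp add: p)
  ultimately show thesis by (rule that)
qed


section \<open>Evaluation and degree\<close>

lemma poly_eval_0: "poly_eval x 0 = 0"
  by (simp add: poly_eval_def)

lemma poly_eval_diff: "poly_eval x (p - q) = poly_eval x p - poly_eval x q"
  using poly_eval_add[of x "p - q" q] by simp

lemma poly_eval_sum: "poly_eval x (\<Sum>i\<in>A. f i) = (\<Sum>i\<in>A. poly_eval x (f i))"
  by (induction A rule: infinite_finite_induct) (simp_all add: poly_eval_0 poly_eval_add)

lemma poly_eval_const: "poly_eval x (Poly_Mapping.single 0 c) = c"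
  by (simp add: poly_eval_single)

lemma poly_eval_power: "poly_eval x (p ^ i) = poly_eval x p ^ i"
  using poly_eval_const[of x 1] by (induction i) (simp_all add: poly_eval_mult)

lemma total_degree_le_iff:
  "total_degree p \<le> d \<longleftrightarrow>
    (\<forall>m\<in>Poly_Mapping.keys p. (\<Sum>e\<in>UNIV. Poly_Mapping.lookup m e) \<le> d)"
  by (simp add: total_degree_def)

lemma total_degree_const: "total_degree (Poly_Mapping.single 0 c) = 0"
  by (simp add: total_degree_def)

lemma total_degree_add_le:
  "total_degree p \<le> d \<Longrightarrow> total_degree q \<le> d \<Longrightarrow> total_degree (p + q) \<le> d"
  using Poly_Mapping.keys_add[of p q] unfolding total_degree_le_iff by blast

lemma total_degree_diff_le:
  "total_degree p \<le> d \<Longrightarrow> total_degree q \<le> d \<Longrightarrow> total_degree (p - q) \<le> d"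
  using keys_diff[of p q] unfolding total_degree_le_iff by blast

lemma total_degree_sum_le:
  "(\<And>i. i \<in> A \<Longrightarrow> total_degree (f i) \<le> d) \<Longrightarrow> total_degree (\<Sum>i\<in>A. f i) \<le> d"
proof (induction A rule: infinite_finite_induct)
  case (insert i A)
  then show ?case by (simp add: total_degree_add_le)
qed (simp_all add: total_degree_le_iff)

lemma total_degree_mult_le: "total_degree (p * q) \<le> total_degree p + total_degree q"
  unfolding total_degree_le_iff
proof
  fix m assume "m \<in> Poly_Mapping.keys (p * q)"
  then obtain a b where ab: "a \<in> Poly_Mapping.keys p" "b \<in> Poly_Mapping.keys q" "m = a + b"
    using keys_mult[of p q] by blast
  have "(\<Sum>e\<in>UNIV. Poly_Mapping.lookup a e) \<le> total_degree p"
    "(\<Sum>e\<in>UNIV. Poly_Mapping.lookup b e) \<le> total_degree q"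
    using ab total_degree_le_iff by blast+
  then show "(\<Sum>e\<in>UNIV. Poly_Mapping.lookup m e) \<le> total_degree p + total_degree q"
    by (simp add: ab(3) lookup_add sum.distrib)
qed

lemma total_degree_power_le: "total_degree (p ^ i) \<le> i * total_degree p"
proof (induction i)
  case 0
  show ?case using total_degree_const[of 1] by simp
next
  case (Suc i)
  then show ?case using total_degree_mult_le[of p "p ^ i"] by simp
qed

section \<open>Polynomials of degree at most 1 as affine functionals\<close>

definition affine_mpoly :: "real \<Rightarrow> real ^ 'e::finite \<Rightarrow> 'e mpoly" where
  "affine_mpoly a b =
    Poly_Mapping.single 0 a + (\<Sum>e\<in>UNIV. Poly_Mapping.single (Poly_Mapping.single e 1) (b $ e))"

lemma poly_eval_affine_mpoly: "poly_eval x (affine_mpoly a b) = a + b \<bullet> x"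
proof -
  have "(\<Prod>e'\<in>UNIV. (x $ e') ^ Poly_Mapping.lookup (Poly_Mapping.single e 1) e') = x $ e" for e
  proof -
    have "(\<Prod>e'\<in>UNIV. (x $ e') ^ Poly_Mapping.lookup (Poly_Mapping.single e 1) e')
        = (\<Prod>e'\<in>UNIV. if e = e' then x $ e' else 1)"
      by (intro prod.cong) (auto simp: lookup_single)
    then show ?thesis by (simp add: prod.delta)
  qed
  then show ?thesis
    by (simp add: affine_mpoly_def poly_eval_add poly_eval_const poly_eval_sum poly_eval_single
        inner_vec_def)
qed

lemma total_degree_affine_mpoly: "total_degree (affine_mpoly a b) \<le> 1"
  unfolding affine_mpoly_def
proof (intro total_degree_add_le total_degree_sum_le)
  show "total_degree (Poly_Mapping.single (Poly_Mapping.single e 1) (b $ e)) \<le> 1" for e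
    by (auto simp: total_degree_le_iff lookup_single when_def)
qed (simp add: total_degree_const)

lemma monomial_degree_le_1_affine:
  fixes m :: "'e::finite \<Rightarrow>\<^sub>0 nat"
  assumes "(\<Sum>e\<in>UNIV. Poly_Mapping.lookup m e) \<le> 1"
  shows "\<exists>a b. \<forall>x :: real ^ 'e. (\<Prod>e\<in>UNIV. (x $ e) ^ Poly_Mapping.lookup m e) = a + b \<bullet> x"
proof (cases "\<forall>e. Poly_Mapping.lookup m e = 0")
  case True
  then show ?thesis by (intro exI[of _ 1] exI[of _ 0]) simp
next
  case False
  then obtain e where e: "Poly_Mapping.lookup m e \<noteq> 0" by blast
  have "(\<Sum>e\<in>UNIV. Poly_Mapping.lookup m e)
      = Poly_Mapping.lookup m e + (\<Sum>e'\<in>UNIV - {e}. Poly_Mapping.lookup m e')"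
    by (rule sum.remove) auto
  then have "Poly_Mapping.lookup m e = 1" "(\<Sum>e'\<in>UNIV - {e}. Poly_Mapping.lookup m e') = 0"
    using e assms by linarith+
  then have "Poly_Mapping.lookup m e' = (if e = e' then 1 else 0)" for e'
    by (cases "e = e'") (auto simp del: One_nat_def)
  then have "(\<Prod>e'\<in>UNIV. (x $ e') ^ Poly_Mapping.lookup m e')
      = (\<Prod>e'\<in>UNIV. if e = e' then x $ e' else 1)" for x :: "real ^ 'e"
    by (intro prod.cong) auto
  then have "(\<Prod>e'\<in>UNIV. (x $ e') ^ Poly_Mapping.lookup m e') = 0 + axis e 1 \<bullet> x" for x :: "real ^ 'e"
    by (simp add: prod.delta inner_axis inner_commute)
  then show ?thesis by blast
qed

lemma poly_eval_affine:
  fixes f :: "'e::finite mpoly"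
  assumes "total_degree f \<le> 1"
  shows "\<exists>a b. \<forall>x. poly_eval x f = a + b \<bullet> x"
proof -
  have "\<forall>m\<in>Poly_Mapping.keys f. \<exists>a b. \<forall>x :: real ^ 'e.
      (\<Prod>e\<in>UNIV. (x $ e) ^ Poly_Mapping.lookup m e) = a + b \<bullet> x"
    using assms monomial_degree_le_1_affine by (auto simp: total_degree_le_iff)
  then obtain a b where ab: "\<And>m x. m \<in> Poly_Mapping.keys f \<Longrightarrow>
      (\<Prod>e\<in>UNIV. ((x :: real ^ 'e) $ e) ^ Poly_Mapping.lookup m e) = a m + b m \<bullet> x"
    by metis
  have "poly_eval x f = (\<Sum>m\<in>Poly_Mapping.keys f. Poly_Mapping.lookup f m * a m)
      + (\<Sum>m\<in>Poly_Mapping.keys f. Poly_Mapping.lookup f m *\<^sub>R b m) \<bullet> x" for x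
    by (simp add: poly_eval_def ab distrib_left sum.distrib inner_sum_left)
  then show ?thesis by blast
qed

definition substitute :: "real poly \<Rightarrow> 'e::finite mpoly \<Rightarrow> 'e mpoly" where
  "substitute q f = (\<Sum>i\<le>degree q. Poly_Mapping.single 0 (coeff q i) * f ^ i)"

lemma poly_eval_substitute: "poly_eval x (substitute q f) = poly q (poly_eval x f)"
  by (simp add: substitute_def poly_eval_sum poly_eval_mult poly_eval_const poly_eval_power
      poly_altdef)

text \<open>Transfers the degree bound of a univariate sum-of-squares certificate to several
  variables.\<close>

lemma total_degree_substitute:
  assumes "total_degree f \<le> 1"
  shows "total_degree (substitute q f) \<le> degree q"
  unfolding substitute_def
proof (rule total_degree_sum_le)
  fix i assume "i \<in> {..degree q}"
  have "total_degree (Poly_Mapping.single 0 (coeff q i) * f ^ i) \<le> 0 + i * total_degree f"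
    using total_degree_mult_le total_degree_power_le by (metis add_mono order_trans total_degree_const le_refl)
  also have "\<dots> \<le> i" using assms by (cases "total_degree f") auto
  also have "\<dots> \<le> degree q" using \<open>i \<in> _\<close> by simp
  finally show "total_degree (Poly_Mapping.single 0 (coeff q i) * f ^ i) \<le> degree q" .
qed


section \<open>Theta bodies of vanishing ideals\<close>

definition vanishing_ideal :: "(real ^ 'e::finite) set \<Rightarrow> 'e mpoly set" where
  "vanishing_ideal X = {p. \<forall>x\<in>X. poly_eval x p = 0}"

text \<open>Only values on \<open>X\<close> matter: the difference between \<open>f\<close> and the
  sum of squares serves as the ideal element.\<close>

lemma sos_mod_vanishing_ideal:
  fixes f :: "'e::finite mpoly"
  shows "sos_mod k (vanishing_ideal X) f \<longleftrightarrow>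
    (\<exists>(t::nat) g. (\<forall>i<t. total_degree (g i) \<le> k) \<and>
      (\<forall>x\<in>X. poly_eval x f = (\<Sum>i<t. (poly_eval x (g i))\<^sup>2)))" (is "?L \<longleftrightarrow> ?R")
proof
  assume ?L
  then obtain t :: nat and g :: "nat \<Rightarrow> 'e mpoly" and h where *: "h \<in> vanishing_ideal X" "\<forall>i<t. total_degree (g i) \<le> k"
    "f = (\<Sum>i<t. (g i)\<^sup>2) + h" unfolding sos_mod_def by blast
  then show ?R
    by (intro exI[of _ t] exI[of _ g])
      (simp add: vanishing_ideal_def poly_eval_add poly_eval_sum poly_eval_power)
next
  assume ?R
  then obtain t :: nat and g :: "nat \<Rightarrow> 'e mpoly" where *: "\<forall>i<t. total_degree (g i) \<le> k"
    "\<forall>x\<in>X. poly_eval x f = (\<Sum>i<t. (poly_eval x (g i))\<^sup>2)" by blast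
  have "f - (\<Sum>i<t. (g i)\<^sup>2) \<in> vanishing_ideal X"
    using *(2) by (simp add: vanishing_ideal_def poly_eval_diff poly_eval_sum poly_eval_power)
  moreover have "f = (\<Sum>i<t. (g i)\<^sup>2) + (f - (\<Sum>i<t. (g i)\<^sup>2))" by simp
  ultimately show ?L unfolding sos_mod_def using *(1) by blast
qed

text \<open>Each test polynomial is nonnegative on \<open>X\<close>, and its nonnegativity set is
  closed and convex.\<close>

lemma closure_convex_hull_subset_theta_body:
  "closure (convex hull X) \<subseteq> theta_body k (vanishing_ideal X)"
proof -
  have "closure (convex hull X) \<subseteq> {x. poly_eval x f \<ge> 0}"
    if f: "total_degree f \<le> 1" "sos_mod k (vanishing_ideal X) f" for f
  proof -
    obtain a b where ab: "\<And>x. poly_eval x f = a + b \<bullet> x"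
      using poly_eval_affine[OF f(1)] by blast
    have eq: "{x. poly_eval x f \<ge> 0} = {x. b \<bullet> x \<ge> - a}"
      by (auto simp: ab)
    have "X \<subseteq> {x. poly_eval x f \<ge> 0}"
      using f(2) by (auto simp: sos_mod_vanishing_ideal intro!: sum_nonneg)
    then show ?thesis
      unfolding eq
      by (intro closure_minimal hull_minimal convex_halfspace_ge closed_halfspace_ge)
  qed
  then show ?thesis by (auto simp: theta_body_def)
qed

text \<open>The values of \<open>f\<close> on \<open>X\<close> are interpolation nodes, so
  \<open>f\<close> agrees there with \<open>p\<close> composed with \<open>f\<close>. Splitting
  \<open>p\<close> into two squares of polynomials of degree at most \<open>k\<close> gives the
  certificate.\<close>

lemma sos_mod_natural_values:
  assumes "k > 0" and deg: "total_degree f \<le> 1"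
    and vals: "\<And>x. x \<in> X \<Longrightarrow> \<exists>i<2 * k. poly_eval x f = real i"
  shows "sos_mod k (vanishing_ideal X) f"
proof -
  obtain p :: "real poly" where p: "degree p \<le> 2 * k" "\<And>x. poly p x \<ge> 0"
    "\<And>i. i < 2 * k \<Longrightarrow> poly p (real i) = real i"
    using nonneg_poly_interpolating_identity[OF \<open>k > 0\<close>] by blast
  obtain a b where ab: "p = a\<^sup>2 + b\<^sup>2" "2 * degree a \<le> degree p" "2 * degree b \<le> degree p"
    using nonneg_poly_sum_two_squares p(2) by blast
  define g where "g = (\<lambda>i::nat. substitute (if i = 0 then a else b) f)"
  have "total_degree (g i) \<le> k" for i
    using total_degree_substitute[OF deg, of "if i = 0 then a else b"] ab p(1)
    by (auto simp: g_def split: if_splits)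
  moreover have "poly_eval x f = (\<Sum>i<2. (poly_eval x (g i))\<^sup>2)" if "x \<in> X" for x
  proof -
    obtain i where i: "i < 2 * k" "poly_eval x f = real i" using vals[OF \<open>x \<in> X\<close>] by blast
    have "(\<Sum>i<2. (poly_eval x (g i))\<^sup>2) = poly p (poly_eval x f)"
      by (simp add: numeral_2_eq_2 g_def poly_eval_substitute ab(1))
    then show ?thesis using i p(3) by simp
  qed
  ultimately show ?thesis unfolding sos_mod_vanishing_ideal by blast
qed


section \<open>The even sign vectors and their convex hull\<close>

definition sign_vectors :: "(real ^ 'e::finite) set" where
  "sign_vectors = {x. \<forall>e. x $ e = 1 \<or> x $ e = -1}"

definition even_sign_vectors :: "(real ^ 'e::finite) set" where
  "even_sign_vectors = {x \<in> sign_vectors. (\<Prod>e\<in>UNIV. x $ e) = 1}"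

text \<open>The involution that exchanges sign vectors of product \<open>1\<close> and
  \<open>-1\<close>.\<close>

definition flip :: "'e \<Rightarrow> real ^ 'e::finite \<Rightarrow> real ^ 'e" where
  "flip e x = (\<chi> e'. if e' = e then - x $ e' else x $ e')"

lemma flip_flip: "flip e (flip e x) = x"
  by (simp add: flip_def vec_eq_iff)

lemma flip_sign_vectors: "x \<in> sign_vectors \<Longrightarrow> flip e x \<in> sign_vectors"
  by (auto simp: flip_def sign_vectors_def)

lemma prod_flip: "(\<Prod>e'\<in>UNIV. flip e x $ e') = - (\<Prod>e'\<in>UNIV. x $ e')"
proof -
  have "(\<Prod>e'\<in>UNIV. flip e x $ e') = flip e x $ e * (\<Prod>e'\<in>UNIV - {e}. flip e x $ e')"
    by (rule prod.remove) auto
  also have "\<dots> = - (x $ e * (\<Prod>e'\<in>UNIV - {e}. x $ e'))"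
    by (simp add: flip_def)
  also have "x $ e * (\<Prod>e'\<in>UNIV - {e}. x $ e') = (\<Prod>e'\<in>UNIV. x $ e')"
    by (rule prod.remove[symmetric]) auto
  finally show ?thesis .
qed

lemma finite_sign_vectors: "finite (sign_vectors :: (real ^ 'e::finite) set)"
proof -
  have "sign_vectors \<subseteq> (\<lambda>A. \<chi> e. if e \<in> A then 1 else -1) ` (UNIV :: 'e set set)"
  proof
    fix x :: "real ^ 'e" assume "x \<in> sign_vectors"
    then have "x = (\<chi> e. if e \<in> {e. x $ e = 1} then 1 else -1)"
      by (auto simp: sign_vectors_def vec_eq_iff)
    then show "x \<in> (\<lambda>A. \<chi> e. if e \<in> A then 1 else -1) ` UNIV" by blast
  qed
  then show ?thesis by (rule finite_subset) simp
qed

lemma sign_vectors_prod: "x \<in> sign_vectors \<Longrightarrow> (\<Prod>e\<in>A. x $ e) = 1 \<or> (\<Prod>e\<in>A. x $ e) = -1"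
  by (induction A rule: infinite_finite_induct) (auto simp: sign_vectors_def)

lemma sign_vectors_inner_self: "x \<in> sign_vectors \<Longrightarrow> x \<bullet> (x :: real ^ 'e::finite) = CARD('e)"
proof -
  assume "x \<in> sign_vectors"
  then have "x $ e * x $ e = 1" for e by (auto simp: sign_vectors_def dest: spec[of _ e])
  then show ?thesis by (simp add: inner_vec_def)
qed

lemma sign_vectors_odd_exists: "\<exists>y \<in> sign_vectors. (\<Prod>e\<in>UNIV. y $ e) = -1"
proof -
  \<comment> \<open>\<open>undefined\<close> serves as an arbitrary coordinate.\<close>
  have "flip undefined 1 \<in> sign_vectors"
    by (rule flip_sign_vectors) (simp add: sign_vectors_def)
  moreover have "(\<Prod>e\<in>UNIV. flip undefined 1 $ e) = -1"
    unfolding prod_flip by simp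
  ultimately show ?thesis by blast
qed

lemma sign_vectors_sum_prod:
  fixes w :: "real ^ 'e::finite"
  assumes "w \<in> sign_vectors"
  defines "m \<equiv> card {e. w $ e = -1}"
  shows "(\<Sum>e\<in>UNIV. w $ e) = CARD('e) - 2 * real m" "(\<Prod>e\<in>UNIV. w $ e) = (-1) ^ m"
    "m \<le> CARD('e)"
proof -
  have w: "w $ e = (if w $ e = -1 then -1 else 1)" for e
    using assms(1) by (auto simp: sign_vectors_def)
  have "(\<Sum>e\<in>UNIV. 1 - w $ e) = (\<Sum>e\<in>UNIV. if w $ e = -1 then 2 else 0)"
    by (intro sum.cong refl) (subst w, simp)
  also have "\<dots> = 2 * real m"
    by (simp add: m_def sum.If_cases)
  finally show "(\<Sum>e\<in>UNIV. w $ e) = CARD('e) - 2 * real m"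
    by (simp add: sum_subtractf)
  have "(\<Prod>e\<in>UNIV. w $ e) = (\<Prod>e\<in>UNIV. if w $ e = -1 then -1 else 1)"
    by (intro prod.cong refl) (rule w)
  also have "\<dots> = (-1) ^ m"
    by (simp add: m_def prod.If_cases)
  finally show "(\<Prod>e\<in>UNIV. w $ e) = (-1) ^ m" .
  show "m \<le> CARD('e)" unfolding m_def by (rule card_mono) auto
qed

text \<open>The coordinatewise product of \<open>x\<close> and \<open>y\<close> has product
  \<open>-1\<close>, hence \<open>2 * i + 1\<close> negative entries, each lowering the inner
  product from \<open>CARD('e)\<close> by 2.\<close>

lemma even_odd_sign_vectors_inner:
  fixes x y :: "real ^ 'e::finite"
  assumes x: "x \<in> even_sign_vectors" and y: "y \<in> sign_vectors" "(\<Prod>e\<in>UNIV. y $ e) = -1"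
  obtains i where "2 * i < CARD('e)" "y \<bullet> x = real CARD('e) - 2 - 4 * real i"
proof -
  define w where "w = (\<chi> e. y $ e * x $ e)"
  have "y $ e * x $ e = 1 \<or> y $ e * x $ e = -1" for e
    using x y(1) by (auto simp: sign_vectors_def even_sign_vectors_def dest!: spec[of _ e])
  then have w: "w \<in> sign_vectors" by (simp add: w_def sign_vectors_def)
  define m where "m = card {e. w $ e = -1}"
  have "(\<Prod>e\<in>UNIV. w $ e) = -1"
    using x y(2) by (simp add: w_def prod.distrib even_sign_vectors_def)
  then have "odd m"
    using sign_vectors_sum_prod(2)[OF w] by (cases "even m") (simp_all add: m_def)
  then obtain i where i: "m = 2 * i + 1" by (elim oddE)
  have "y \<bullet> x = (\<Sum>e\<in>UNIV. w $ e)" by (simp add: w_def inner_vec_def)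
  then have "y \<bullet> x = real CARD('e) - 2 - 4 * real i"
    using sign_vectors_sum_prod(1)[OF w] i by (simp add: m_def)
  moreover have "2 * i < CARD('e)"
    using sign_vectors_sum_prod(3)[OF w] i by (simp add: m_def)
  ultimately show thesis by (rule that[rotated])
qed

text \<open>If \<open>a\<close> separated \<open>x\<close> from all even sign vectors, compare \<open>a \<bullet> x\<close> with the minimum of \<open>a\<close>
  over the sign vectors, attained at \<open>y = - sgn a\<close>: when \<open>y\<close> is odd, flipping the coordinate with
  the smallest \<open>\<bar>a $ e\<bar>\<close> costs \<open>2 * \<bar>a $ e\<bar>\<close>, which the inequality for \<open>y\<close> already pays for.\<close>

lemma convex_hull_even_sign_vectorsI:
  fixes x :: "real ^ 'e::finite"
  assumes box: "\<And>e. \<bar>x $ e\<bar> \<le> 1"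
    and odd: "\<And>y. y \<in> sign_vectors \<Longrightarrow> (\<Prod>e\<in>UNIV. y $ e) = -1 \<Longrightarrow> y \<bullet> x \<le> real CARD('e) - 2"
  shows "x \<in> convex hull even_sign_vectors"
proof (rule ccontr)
  assume "x \<notin> convex hull even_sign_vectors"
  moreover have "finite (even_sign_vectors :: (real ^ 'e) set)"
    unfolding even_sign_vectors_def using finite_sign_vectors by auto
  then have "closed (convex hull (even_sign_vectors :: (real ^ 'e) set))"
    by (intro compact_imp_closed finite_imp_compact_convex_hull)
  ultimately obtain a b where ab: "a \<bullet> x < b" "\<forall>z\<in>convex hull even_sign_vectors. a \<bullet> z > b"
    using separating_hyperplane_closed_point[OF convex_convex_hull] by blast
  have sep: "a \<bullet> x < a \<bullet> z" if "z \<in> even_sign_vectors" for z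
    using ab hull_inc[OF that, of convex] by fastforce
  define y where "y = (\<chi> e. if a $ e > 0 then -1 else (1 :: real))"
  have y: "y \<in> sign_vectors" by (simp add: y_def sign_vectors_def)
  have ay: "a $ e = - \<bar>a $ e\<bar> * y $ e" "a $ e * y $ e = - \<bar>a $ e\<bar>" for e
    by (simp_all add: y_def)
  have yx: "y $ e * x $ e \<le> 1" for e
    using box[of e] by (auto simp: y_def)
  \<comment> \<open>The excess of \<open>a \<bullet> x\<close> over the minimum
    \<open>a \<bullet> y\<close> becomes a weighted sum of the nonnegative deficits
    \<open>1 - y $ e * x $ e\<close>.\<close>
  have "(\<Sum>e\<in>UNIV. \<bar>a $ e\<bar> * (1 - y $ e * x $ e)) = (\<Sum>e\<in>UNIV. a $ e * x $ e - a $ e * y $ e)"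
    by (intro sum.cong refl) (subst ay(2), subst (2) ay(1), simp add: algebra_simps)
  then have gap: "(\<Sum>e\<in>UNIV. \<bar>a $ e\<bar> * (1 - y $ e * x $ e)) = a \<bullet> x - a \<bullet> y"
    by (simp add: inner_vec_def sum_subtractf)
  show False
  proof (cases "(\<Prod>e\<in>UNIV. y $ e) = 1")
    case True
    then have "a \<bullet> x < a \<bullet> y" using sep y by (simp add: even_sign_vectors_def)
    moreover have "(\<Sum>e\<in>UNIV. \<bar>a $ e\<bar> * (1 - y $ e * x $ e)) \<ge> 0"
      using yx by (intro sum_nonneg mult_nonneg_nonneg) auto
    ultimately show False using gap by linarith
  next
    case False
    then have y_odd: "(\<Prod>e\<in>UNIV. y $ e) = -1" using sign_vectors_prod[OF y] by blast
    obtain e0 where e0: "\<And>e. \<bar>a $ e0\<bar> \<le> \<bar>a $ e\<bar>"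
      using ex_min_if_finite[of "range (\<lambda>e. \<bar>a $ e\<bar>)"] by (auto simp: not_less) 
    have "flip e0 y \<in> even_sign_vectors"
      using flip_sign_vectors[OF y] y_odd by (simp add: even_sign_vectors_def prod_flip)
    then have "a \<bullet> x < a \<bullet> flip e0 y" by (rule sep)
    also have "a \<bullet> flip e0 y = a \<bullet> y + (\<Sum>e\<in>UNIV. if e = e0 then 2 * \<bar>a $ e\<bar> else 0)"
      unfolding inner_vec_def sum.distrib[symmetric]
      by (intro sum.cong refl) (auto simp: flip_def ay(2))
    also have "\<dots> = a \<bullet> y + \<bar>a $ e0\<bar> * 2" by simp
    \<comment> \<open>The inequality for \<open>y\<close> says that the deficits add up to at least
      2.\<close>
    also have "\<bar>a $ e0\<bar> * 2 \<le> \<bar>a $ e0\<bar> * (\<Sum>e\<in>UNIV. 1 - y $ e * x $ e)"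
      using odd[OF y y_odd] by (intro mult_left_mono) (simp_all add: sum_subtractf inner_vec_def)
    also have "\<dots> \<le> (\<Sum>e\<in>UNIV. \<bar>a $ e\<bar> * (1 - y $ e * x $ e))"
      unfolding sum_distrib_left using e0 yx by (intro sum_mono mult_right_mono) auto
    finally show False using gap by linarith
  qed
qed

text \<open>The ideal contains \<open>(x $ e)^2 - 1\<close> for every \<open>e\<close> and the
  product of all coordinates minus 1, which already cut out these points.\<close>

lemma real_variety_even_sign_vectors:
  "real_variety (vanishing_ideal even_sign_vectors) = (even_sign_vectors :: (real ^ 'e::finite) set)"
proof
  show "even_sign_vectors \<subseteq> real_variety (vanishing_ideal even_sign_vectors :: 'e mpoly set)"
    by (auto simp: real_variety_def vanishing_ideal_def)
next
  show "real_variety (vanishing_ideal even_sign_vectors :: 'e mpoly set) \<subseteq> even_sign_vectors"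
  proof
    fix x :: "real ^ 'e"
    assume "x \<in> real_variety (vanishing_ideal even_sign_vectors)"
    then have x: "poly_eval x p = 0" if "\<And>z. z \<in> even_sign_vectors \<Longrightarrow> poly_eval z p = 0" for p
      using that by (auto simp: real_variety_def vanishing_ideal_def)
    have "x $ e = 1 \<or> x $ e = -1" for e
    proof -
      have p: "poly_eval z ((affine_mpoly 0 (axis e 1))\<^sup>2 - affine_mpoly 1 0) = (z $ e)\<^sup>2 - 1"
        for z :: "real ^ 'e"
        by (simp add: poly_eval_diff poly_eval_power poly_eval_affine_mpoly inner_axis inner_commute)
      have "(x $ e)\<^sup>2 - 1 = 0"
        unfolding p[symmetric]
        by (rule x, unfold p, auto simp: even_sign_vectors_def sign_vectors_def dest: spec[of _ e])
      then show ?thesis by (simp add: power2_eq_1_iff)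
    qed
    moreover have "(\<Prod>e\<in>UNIV. x $ e) = 1"
    proof -
      let ?m = "\<Sum>e\<in>UNIV. Poly_Mapping.single e 1 :: 'e \<Rightarrow>\<^sub>0 nat"
      have "Poly_Mapping.lookup ?m e = 1" for e
        by (simp add: lookup_sum lookup_single when_def)
      then have p: "poly_eval z (Poly_Mapping.single ?m 1 - affine_mpoly 1 0) = (\<Prod>e\<in>UNIV. z $ e) - 1"
        for z :: "real ^ 'e"
        by (simp add: poly_eval_diff poly_eval_single poly_eval_affine_mpoly)
      have "(\<Prod>e\<in>UNIV. x $ e) - 1 = 0"
        unfolding p[symmetric] by (rule x, unfold p, simp add: even_sign_vectors_def)
      then show ?thesis by simp
    qed
    ultimately show "x \<in> even_sign_vectors"
      by (simp add: even_sign_vectors_def sign_vectors_def)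
  qed
qed

text \<open>A monomial of degree below \<open>CARD('e)\<close> omits some variable. Flipping it
  fixes the monomial and negates the full product, so the terms cancel in pairs.\<close>

lemma sum_sign_vectors_low_degree:
  fixes q :: "'e::finite mpoly"
  assumes "total_degree q < CARD('e)"
  shows "(\<Sum>x\<in>sign_vectors. (\<Prod>e\<in>UNIV. x $ e) * poly_eval x q) = 0"
proof -
  have "(\<Sum>x\<in>sign_vectors. (\<Prod>e\<in>UNIV. x $ e) * (\<Prod>e\<in>UNIV. (x $ e) ^ Poly_Mapping.lookup m e)) = 0"
    (is "sum ?f _ = 0") if m: "m \<in> Poly_Mapping.keys q" for m
  proof -
    have lt: "(\<Sum>e\<in>UNIV. Poly_Mapping.lookup m e) < (\<Sum>e\<in>(UNIV :: 'e set). 1)"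
      using assms m total_degree_le_iff[of q "total_degree q"] by fastforce
    have "\<exists>e. Poly_Mapping.lookup m e < 1"
    proof (rule ccontr)
      assume "\<not> ?thesis"
      then have "(\<Sum>e\<in>(UNIV :: 'e set). 1) \<le> (\<Sum>e\<in>UNIV. Poly_Mapping.lookup m e)"
        by (intro sum_mono) (auto simp: not_less Suc_le_eq)
      then show False using lt by linarith
    qed
    then obtain e where e: "Poly_Mapping.lookup m e = 0" by auto
    have "(\<Prod>e'\<in>UNIV. (flip e x $ e') ^ Poly_Mapping.lookup m e')
        = (\<Prod>e'\<in>UNIV. (x $ e') ^ Poly_Mapping.lookup m e')" for x
      by (intro prod.cong refl) (auto simp: flip_def e)
    then have "?f (flip e x) = - ?f x" for x by (simp add: prod_flip)
    moreover have "sum ?f sign_vectors = (\<Sum>x\<in>sign_vectors. ?f (flip e x))"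
      by (rule sum.reindex_bij_witness[of _ "flip e" "flip e"])
        (auto simp: flip_flip flip_sign_vectors)
    ultimately have "sum ?f sign_vectors = - sum ?f sign_vectors"
      by (simp add: sum_negf)
    then show ?thesis by simp
  qed
  then have "(\<Sum>m\<in>Poly_Mapping.keys q. Poly_Mapping.lookup q m * (\<Sum>x\<in>sign_vectors.
      (\<Prod>e\<in>UNIV. x $ e) * (\<Prod>e\<in>UNIV. (x $ e) ^ Poly_Mapping.lookup m e))) = 0"
    by simp
  then show ?thesis
    unfolding poly_eval_def sum_distrib_left
    by (subst sum.swap) (simp add: mult.left_commute)
qed

text \<open>As \<open>h\<close> vanishes where the product of the coordinates is \<open>1\<close>, the product times \<open>h\<^sup>2\<close>,
  which sums to zero over all sign vectors, is \<open>- h\<^sup>2\<close> everywhere.\<close>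

lemma low_degree_vanishing:
  fixes h :: "'e::finite mpoly"
  assumes "2 * total_degree h < CARD('e)" and h: "h \<in> vanishing_ideal even_sign_vectors"
    and "x \<in> sign_vectors"
  shows "poly_eval x h = 0"
proof -
  have "total_degree (h\<^sup>2) < CARD('e)"
    using total_degree_power_le[of h 2] assms(1) by linarith
  then have "(\<Sum>x\<in>sign_vectors. (\<Prod>e\<in>UNIV. x $ e) * (poly_eval x h)\<^sup>2) = 0"
    using sum_sign_vectors_low_degree[of "h\<^sup>2"] by (simp add: poly_eval_power)
  moreover have "(\<Prod>e\<in>UNIV. x $ e) * (poly_eval x h)\<^sup>2 = - (poly_eval x h)\<^sup>2"
    if "x \<in> sign_vectors" for x
    using sign_vectors_prod[OF that, of UNIV] h that
    by (auto simp: vanishing_ideal_def even_sign_vectors_def)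
  ultimately have "(\<Sum>x\<in>sign_vectors. (poly_eval x h)\<^sup>2) = 0"
    by (simp add: sum_negf)
  then show ?thesis
    using assms(3) finite_sign_vectors by (subst (asm) sum_nonneg_eq_0_iff) auto
qed

lemma theta_exact_even_sign_vectors:
  assumes "k > 0"
  shows "theta_exact k (vanishing_ideal (even_sign_vectors :: (real ^ 'e::finite) set))
    \<longleftrightarrow> CARD('e) \<le> 4 * k"
proof
  let ?X = "even_sign_vectors :: (real ^ 'e) set"
  assume exact: "theta_exact k (vanishing_ideal ?X)"
  show "CARD('e) \<le> 4 * k"
  proof (rule ccontr)
    assume small: "\<not> CARD('e) \<le> 4 * k"
    \<comment> \<open>This \<open>y\<close> passes every test of the theta body but violates its own
      inequality, because \<open>y \<bullet> y = CARD('e)\<close>.\<close>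
    obtain y :: "real ^ 'e" where y: "y \<in> sign_vectors" "(\<Prod>e\<in>UNIV. y $ e) = -1"
      using sign_vectors_odd_exists by blast
    have "poly_eval y f \<ge> 0" if f: "total_degree f \<le> 1" "sos_mod k (vanishing_ideal ?X) f" for f
    proof -
      obtain t :: nat and g h where *: "h \<in> vanishing_ideal ?X" "\<And>i. i < t \<Longrightarrow> total_degree (g i) \<le> k"
        "f = (\<Sum>i<t. (g i)\<^sup>2) + h"
        using f(2) unfolding sos_mod_def by metis
      have "total_degree ((g i)\<^sup>2) \<le> 2 * k" if "i < t" for i
        using total_degree_power_le[of "g i" 2] *(2)[OF that] by linarith
      \<comment> \<open>This difference is \<open>h\<close>, whose degree is therefore at most
        \<open>2 * k\<close>; hence
        \<open>2 * total_degree h \<le> 4 * k < CARD('e)\<close>.\<close>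
      then have "total_degree (f - (\<Sum>i<t. (g i)\<^sup>2)) \<le> 2 * k"
        using f(1) assms by (intro total_degree_diff_le total_degree_sum_le) auto
      then have "2 * total_degree h < CARD('e)" using small *(3) by simp
      then have "poly_eval y h = 0" using low_degree_vanishing *(1) y(1) by blast
      then show ?thesis
        by (simp add: *(3) poly_eval_add poly_eval_sum poly_eval_power sum_nonneg)
    qed
    then have "y \<in> closure (convex hull ?X)"
      using exact by (auto simp: theta_exact_def theta_body_def real_variety_even_sign_vectors)
    moreover have "closure (convex hull ?X) \<subseteq> {x. y \<bullet> x \<le> real CARD('e) - 2}"
    proof (intro closure_minimal hull_minimal convex_halfspace_le closed_halfspace_le subsetI CollectI)
      fix x assume "x \<in> ?X"
      then obtain i where "y \<bullet> x = real CARD('e) - 2 - 4 * real i"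
        using even_odd_sign_vectors_inner y by blast
      then show "y \<bullet> x \<le> real CARD('e) - 2" by simp
    qed
    ultimately show False using sign_vectors_inner_self[OF y(1)] by auto
  qed
next
  let ?X = "even_sign_vectors :: (real ^ 'e) set"
  assume large: "CARD('e) \<le> 4 * k"
  have "theta_body k (vanishing_ideal ?X) \<subseteq> convex hull ?X"
  proof
    fix x assume x: "x \<in> theta_body k (vanishing_ideal ?X)"
    have nonneg: "a + b \<bullet> x \<ge> 0"
      if "\<And>z. z \<in> ?X \<Longrightarrow> \<exists>i<2 * k. a + b \<bullet> z = real i" for a b
    proof -
      have "sos_mod k (vanishing_ideal ?X) (affine_mpoly a b)"
        using assms that
        by (intro sos_mod_natural_values total_degree_affine_mpoly) (simp_all add: poly_eval_affine_mpoly)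
      then have "poly_eval x (affine_mpoly a b) \<ge> 0"
        using x total_degree_affine_mpoly by (auto simp: theta_body_def)
      then show ?thesis by (simp add: poly_eval_affine_mpoly)
    qed
    show "x \<in> convex hull ?X"
    proof (rule convex_hull_even_sign_vectorsI)
      fix e
      \<comment> \<open>The rescaled box inequalities: \<open>(1 + c * x $ e) / 2\<close> takes only
        the values 0 and 1 on \<open>?X\<close>.\<close>
      have "1 / 2 + axis e (c / 2) \<bullet> x \<ge> 0" if c: "c = 1 \<or> c = -1" for c :: real
      proof (rule nonneg)
        fix z :: "real ^ 'e" assume "z \<in> ?X"
        then have "z $ e = 1 \<or> z $ e = -1"
          by (simp add: even_sign_vectors_def sign_vectors_def)
        then have "1 / 2 + axis e (c / 2) \<bullet> z = real 0 \<or> 1 / 2 + axis e (c / 2) \<bullet> z = real 1"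
          using c by (auto simp: inner_axis inner_commute[of "axis e _"])
        moreover have "0 < 2 * k" "1 < 2 * k" using assms by auto
        ultimately show "\<exists>i<2 * k. 1 / 2 + axis e (c / 2) \<bullet> z = real i" by blast
      qed
      from this[of 1] this[of "-1"] show "\<bar>x $ e\<bar> \<le> 1"
        by (simp add: inner_axis inner_commute[of "axis e _"])
    next
      fix y :: "real ^ 'e" assume y: "y \<in> sign_vectors" "(\<Prod>e\<in>UNIV. y $ e) = -1"
      \<comment> \<open>Division by 4 turns the slack of the inequality for \<open>y\<close> into
        the natural number \<open>i\<close>, and \<open>2 * i < CARD('e) \<le> 4 * k\<close> gives
        \<open>i < 2 * k\<close>.\<close>
      have "(real CARD('e) - 2) / 4 + ((- 1 / 4) *\<^sub>R y) \<bullet> x \<ge> 0"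
      proof (rule nonneg)
        fix z assume "z \<in> ?X"
        then obtain i where "2 * i < CARD('e)" "y \<bullet> z = real CARD('e) - 2 - 4 * real i"
          using even_odd_sign_vectors_inner y by blast
        then show "\<exists>i<2 * k. (real CARD('e) - 2) / 4 + ((- 1 / 4) *\<^sub>R y) \<bullet> z = real i"
          using large by (intro exI[of _ i]) (auto simp: field_simps)
      qed
      then show "y \<bullet> x \<le> real CARD('e) - 2" by simp
    qed
  qed
  then show "theta_exact k (vanishing_ideal ?X)"
    using closure_convex_hull_subset_theta_body[of ?X k] closure_subset[of "convex hull ?X"]
    unfolding theta_exact_def real_variety_even_sign_vectors by blast
qed


section \<open>Cuts of a cycle\<close>

lemma bij_betw_Suc_mod: "bij_betw (\<lambda>i. Suc i mod n) {..<n} {..<n}"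
proof (rule bij_betwI')
  show "(Suc i mod n = Suc j mod n) = (i = j)" if "i \<in> {..<n}" "j \<in> {..<n}" for i j
    using that by (auto simp: mod_Suc split: if_splits)
  show "Suc i mod n \<in> {..<n}" if "i \<in> {..<n}" for i
    using that by auto
  show "\<exists>i\<in>{..<n}. j = Suc i mod n" if "j \<in> {..<n}" for j
    using that by (intro bexI[of _ "if j = 0 then n - 1 else j - 1"]) (auto split: if_splits)
qed

text \<open>A cut gives each vertex a sign, and an edge coordinate is the product of the signs at
  its ends. Around the cycle every vertex sign occurs twice, so the total product is 1; conversely,
  partial products recover the vertex signs.\<close>

lemma cycle_cut_vectors:
  fixes V :: "'a set" and inc :: "'e::finite \<Rightarrow> 'a set"
  assumes "n \<ge> 2" "cycle_graph n V inc"
  shows "(\<lambda>S. cut_vector (cut inc S)) ` Pow V = even_sign_vectors"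
proof -
  obtain v d where v: "bij_betw v {..<n} V" and d: "bij_betw d {..<n} (UNIV :: 'e set)"
    and inc: "\<And>i. i < n \<Longrightarrow> inc (d i) = {v i, v (Suc i mod n)}"
    using assms(2) unfolding cycle_graph_def by blast
  have edge: "\<exists>i<n. e = d i" for e
    using d unfolding bij_betw_def by auto
  have cut_d: "cut_vector (cut inc S) $ d i =
      (if v i \<in> S then -1 else 1) * (if v (Suc i mod n) \<in> S then -1 else 1)" if "i < n" for S i
  proof -
    have "i \<noteq> Suc i mod n" using that assms(1) by (auto simp: mod_Suc)
    moreover have "Suc i mod n < n" using that by simp
    ultimately have "v i \<noteq> v (Suc i mod n)"
      using v that unfolding bij_betw_def inj_on_def by blast
    then show ?thesis
      using that by (auto simp: cut_vector_def cut_def inc Int_insert_left)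
  qed
  show ?thesis
  proof (intro equalityI subsetI)
    fix x assume "x \<in> (\<lambda>S. cut_vector (cut inc S)) ` Pow V"
    then obtain S where x: "x = cut_vector (cut inc S)" by blast
    let ?s = "\<lambda>i. if v i \<in> S then -1 else 1 :: real"
    have "(\<Prod>e\<in>UNIV. x $ e) = (\<Prod>i<n. x $ d i)"
      by (rule prod.reindex_bij_betw[OF d, symmetric])
    also have "\<dots> = (\<Prod>i<n. ?s i) * (\<Prod>i<n. ?s (Suc i mod n))"
      by (simp add: x cut_d prod.distrib)
    also have "(\<Prod>i<n. ?s (Suc i mod n)) = (\<Prod>i<n. ?s i)"
      by (rule prod.reindex_bij_betw[OF bij_betw_Suc_mod])
    also have "(\<Prod>i<n. ?s i) * (\<Prod>i<n. ?s i) = (\<Prod>i<n. ?s i * ?s i)"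
      by (rule prod.distrib[symmetric])
    also have "\<dots> = 1" by (intro prod.neutral) simp
    finally show "x \<in> even_sign_vectors"
      by (simp add: even_sign_vectors_def sign_vectors_def x cut_vector_def)
  next
    fix x :: "real ^ 'e" assume x: "x \<in> even_sign_vectors"
    \<comment> \<open>The sign of vertex \<open>v i\<close>, normalised to 1 at \<open>v 0\<close>
      and propagated along the edges.\<close>
    define s where "s = (\<lambda>i. \<Prod>j<i. x $ d j)"
    define S where "S = v ` {i \<in> {..<n}. s i = -1}"
    have s: "s i = 1 \<or> s i = -1" for i
    proof (induction i)
      case (Suc i)
      moreover have "x $ d i = 1 \<or> x $ d i = -1"
        using x by (simp add: even_sign_vectors_def sign_vectors_def)
      ultimately show ?case by (auto simp: s_def)
    qed (simp add: s_def)
    have "s n = (\<Prod>e\<in>UNIV. x $ e)"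
      unfolding s_def by (rule prod.reindex_bij_betw[OF d])
    \<comment> \<open>Total product 1 is what makes the signs consistent across the closing edge
      \<open>d (n - 1)\<close>.\<close>
    then have "s n = s 0" using x by (simp add: even_sign_vectors_def s_def)
    then have s_mod: "s (Suc i mod n) = s i * x $ d i" if "i < n" for i
      using that by (cases "Suc i = n") (auto simp: s_def)
    have "v i \<in> S \<longleftrightarrow> s i = -1" if "i < n" for i
      using that v unfolding S_def bij_betw_def by (auto dest: inj_onD)
    then have "(if v i \<in> S then -1 else 1) = s i" if "i < n" for i
      using that s[of i] by auto
    then have "cut_vector (cut inc S) $ d i = s i * (s i * x $ d i)" if "i < n" for i
      using that by (simp add: cut_d s_mod)
    then have "cut_vector (cut inc S) $ d i = x $ d i" if "i < n" for i
      using that s[of i] by auto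
    then have "x = cut_vector (cut inc S)"
      using edge by (metis vec_eq_iff)
    moreover have "S \<subseteq> V" using v by (auto simp: S_def bij_betw_def)
    ultimately show "x \<in> (\<lambda>S. cut_vector (cut inc S)) ` Pow V" by blast
  qed
qed

theorem corollary5p7:
  fixes V :: "'a set" and inc :: "'e::finite \<Rightarrow> 'a set" and n :: nat
  assumes "n \<ge> 3"
    and "cycle_graph n V inc"
  shows "nat \<lceil>real n / 4\<rceil> > 0
    \<and> theta_exact (nat \<lceil>real n / 4\<rceil>) (cut_ideal V inc)
    \<and> (\<forall>k. k > 0 \<and> theta_exact k (cut_ideal V inc) \<longrightarrow> nat \<lceil>real n / 4\<rceil> \<le> k)"
proof -
  have "cut_ideal V inc = vanishing_ideal ((\<lambda>S. cut_vector (cut inc S)) ` Pow V)"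
    by (auto simp: cut_ideal_def vanishing_ideal_def)
  also have "\<dots> = vanishing_ideal even_sign_vectors"
    using cycle_cut_vectors[OF _ assms(2)] assms(1) by simp
  finally have exact: "theta_exact k (cut_ideal V inc) \<longleftrightarrow> n \<le> 4 * k" if "k > 0" for k
    using theta_exact_even_sign_vectors[OF that, where 'e = 'e] cycle_graph_card(2)[OF assms(2)] by simp
  \<comment> \<open>Together with \<open>exact\<close>, this equivalence yields both exactness at
    the ceiling and its minimality.\<close>
  have le: "nat \<lceil>real n / 4\<rceil> \<le> k \<longleftrightarrow> n \<le> 4 * k" for k
    by (simp add: nat_le_iff ceiling_le_iff) linarith
  moreover have "nat \<lceil>real n / 4\<rceil> > 0" using assms(1) by simp
  ultimately show ?thesis using exact by blast
qed

end
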